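(* Let $L\ge 2$ be even, $A=\{1,L\}$, and let $n,d,e\in\mathbb{N}$. Let $f_A^{I},f_A^{II},g_A^{I},g_A^{II}$ and $X$ be as defined in the context. 1. If $d\ge f_A^{I}(n)$ and $e<f_A^{II}(n)$, then $W_A^{\rm cash}(n;d,e)=\mathrm{I}$. 2. If $d<f_A^{I}(n)$ and $e\ge f_A^{II}(n)$, then $W_A^{\rm cash}(n;d,e)=\mathrm{II}$. 3. If $d\ge f_A^{I}(n)$ and $e\ge f_A^{II}(n)$, then $W_A^{\rm cash}(n;d,e)=W_A(n)$. 4. If $d\ge g_A^{I}(n)$ and $e<g_A^{II}(n)$, then $W_A^{\rm cash}(n;d,e)=\mathrm{I}$. 5. If $d<g_A^{I}(n)$ and $e\ge g_A^{II}(n)$, then $W_A^{\rm cash}(n;d,e)=\mathrm{II}$. 6. If $d<g_A^{I}(n)$ and $e<g_A^{II}(n)$, then $W_A^{\rm cash}(n;d,e)=\mathrm{I}$ if and only if $d>e$. 7. If $g_A^{I}(n)\le d<f_A^{I}(n)$ and $g_A^{II}(n)\le e<f_A^{II}(n)$, let $i\in\{0,\dots,L\}$ with $n\equiv i\pmod{L+1}$, $b=f_A^{I}(n)-d-1$ and $b^\dagger=f_A^{II}(n)-e-1$. Then $W_A^{\rm cash}(n;d,e)=\mathrm{I}$ if and only if $(i,b,b^\dagger)\in X$.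
   Context: $\mathbb{N}=\{0,1,2,\dots\}$; $L=2\ell$. NIM for $A$: there are $n$ stones on the board. Players I and II alternate, Player I first, each removing $a\in A$ stones ($a$ at most the number of stones present). A player who cannot move loses. $W_A(n)\in\{\mathrm{I},\mathrm{II}\}$ is the player with a winning strategy; for $A=\{1,L\}$ one has $W_A(n)=\mathrm{II}$ iff $n\equiv 0,2,4,\dots,L-2\pmod{L+1}$. NIM with cash for $A$, state $(n;d,e)$: $n$ stones are on the board, Player I (who moves first) has $d$ dollars and Player II has $e$ dollars. Players alternate. A player removing $a\in A$ stones also loses $a$ dollars, so $a$ may exceed neither the number of stones nor the mover's dollars. A player who cannot move (no stones left, or he has no dollars) loses. $W_A^{\rm cash}(n;d,e)\in\{\mathrm{I},\mathrm{II}\}$ is the player with a winning strategy. Write $n=k(L+1)+i$ with $0\le i\le L$. Define - $f_A(n)=Lk+\lceil i/2\rceil$ if $i<L$, and $f_A(n)=L(k+1)$ if $i=L$; - $f_A^{\bot}(n)=\lfloor n/2\rfloor$ if $n<L$; $f_A^{\bot}(n)=Lk+\lfloor i/2\rfloor-\ell+1$ if $n\ge L$ and $i<L$; $f_A^{\bot}(n)=Lk+\ell$ if $i=L$. If $W_A(n)=\mathrm{I}$ then $f_A^{I}(n)=f_A(n)$ and $f_A^{II}(n)=f_A^{\bot}(n)$; if $W_A(n)=\mathrm{II}$ then $f_A^{II}(n)=f_A(n)$ and $f_A^{I}(n)=f_A^{\bot}(n)$. If $n$ is even, $g_A^{I}(n)=\frac n2+1$ and $g_A^{II}(n)=\frac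 n2$; if $n$ is odd, $g_A^{I}(n)=g_A^{II}(n)=\frac{n-1}{2}+1$. $X$ is the set of integer triples $(i,x,y)$ with $0\le i\le L$, $x,y\ge0$ such that: - if $i\in\{0,2,\dots,L-2\}$: $x<\left\lfloor\frac{y}{L-1}\right\rfloor(L-1)$; - if $i\in\{1,3,\dots,L-1\}$ or $i=L$: $y\ge\left\lfloor\frac{x}{L-1}\right\rfloor(L-1)$. *)

theory Defs
  imports Main
begin

section \<open>Two-player games and winning strategies\<close>

text \<open>
  A game is given by a function assigning to the player to move and to the current position
  the set of positions he may move to.  A play is recorded as the nonempty list of the
  positions visited so far; Player I makes the first move, and the players alternate.
\<close>

datatype player = Player_I | Player_II

type_synonym 's game = "player \<Rightarrow> 's \<Rightarrow> 's set"

definition to_move :: "'s list \<Rightarrow> player" where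
  "to_move h = (if odd (length h) then Player_I else Player_II)"

inductive play :: "'s game \<Rightarrow> 's \<Rightarrow> 's list \<Rightarrow> bool" for G s where
  start: "play G s [s]"
| step: "play G s h \<Longrightarrow> t \<in> G (to_move h) (last h) \<Longrightarrow> play G s (h @ [t])"

text \<open>
  A strategy may depend on the whole history; \<open>conforms \<sigma> P h\<close> says that all moves of the
  player \<open>P\<close> in \<open>h\<close> were made according to \<open>\<sigma>\<close>.
\<close>

definition conforms :: "('s list \<Rightarrow> 's) \<Rightarrow> player \<Rightarrow> 's list \<Rightarrow> bool" where
  "conforms \<sigma> P h \<longleftrightarrow>
     (\<forall>k. 0 < k \<and> k < length h \<and> to_move (take k h) = P \<longrightarrow> h ! k = \<sigma> (take k h))"

text \<open>
  A winning strategy for \<open>P\<close> makes a legal move whenever \<open>P\<close> has one, and in every completed play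
  conforming to it the player who cannot move (and hence loses) is not \<open>P\<close>.
  All games below are finite, so infinite plays need no convention.
\<close>

definition winning_strategy :: "'s game \<Rightarrow> 's \<Rightarrow> player \<Rightarrow> ('s list \<Rightarrow> 's) \<Rightarrow> bool" where
  "winning_strategy G s P \<sigma> \<longleftrightarrow>
     (\<forall>h. play G s h \<and> conforms \<sigma> P h \<longrightarrow>
        (if G (to_move h) (last h) = {} then to_move h \<noteq> P
         else to_move h = P \<longrightarrow> \<sigma> h \<in> G P (last h)))"

definition winner :: "'s game \<Rightarrow> 's \<Rightarrow> player" where
  "winner G s = (THE P. \<exists>\<sigma>. winning_strategy G s P \<sigma>)"


section \<open>NIM and NIM with cash\<close>

definition nim :: "nat set \<Rightarrow> nat game" where
  "nim A P n = {n - a | a. a \<in> A \<and> a \<le> n}"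

definition W :: "nat set \<Rightarrow> nat \<Rightarrow> player" where
  "W A n = winner (nim A) n"

text \<open>Positions \<open>(n, d, e)\<close>: stones, dollars of Player I, dollars of Player II.\<close>

fun nim_cash :: "nat set \<Rightarrow> (nat \<times> nat \<times> nat) game" where
  "nim_cash A Player_I (n, d, e) = {(n - a, d - a, e) | a. a \<in> A \<and> a \<le> n \<and> a \<le> d}"
| "nim_cash A Player_II (n, d, e) = {(n - a, d, e - a) | a. a \<in> A \<and> a \<le> n \<and> a \<le> e}"

definition W_cash :: "nat set \<Rightarrow> nat \<Rightarrow> nat \<Rightarrow> nat \<Rightarrow> player" where
  "W_cash A n d e = winner (nim_cash A) (n, d, e)"


section \<open>The winner is well defined\<close>

fun other :: "player \<Rightarrow> player" where
  "other Player_I = Player_II"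
| "other Player_II = Player_I"

lemma to_move_snoc: "to_move (h @ [t]) = other (to_move h)"
  by (simp add: to_move_def)

lemma play_nonempty: "play G s h \<Longrightarrow> h \<noteq> []"
  by (induction rule: play.induct) auto

lemma conforms_singleton: "conforms \<sigma> P [s]"
  by (simp add: conforms_def)

lemma conforms_snoc:
  assumes "h \<noteq> []"
  shows "conforms \<sigma> P (h @ [t]) \<longleftrightarrow> conforms \<sigma> P h \<and> (to_move h = P \<longrightarrow> t = \<sigma> h)"
  using assms unfolding conforms_def
  by (auto simp: nth_append less_Suc_eq)

inductive mover_wins mover_loses :: "'s game \<Rightarrow> player \<Rightarrow> 's \<Rightarrow> bool" for G where
  "t \<in> G p s \<Longrightarrow> mover_loses G (other p) t \<Longrightarrow> mover_wins G p s"
| "(\<And>t. t \<in> G p s \<Longrightarrow> mover_wins G (other p) t) \<Longrightarrow> mover_loses G p s"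

lemma mover_wins_or_loses:
  fixes m :: "'s \<Rightarrow> nat"
  assumes "\<And>p s t. t \<in> G p s \<Longrightarrow> m t < m s"
  shows "mover_wins G p s \<or> mover_loses G p s"
proof (induction s arbitrary: p rule: measure_induct_rule[of m])
  case (less s)
  show ?case
  proof (cases "\<exists>t\<in>G p s. mover_loses G (other p) t")
    case True
    then show ?thesis by (blast intro: mover_wins_mover_loses.intros(1))
  next
    case False
    then have "mover_wins G (other p) t" if "t \<in> G p s" for t
      using less.IH[OF assms[OF that], of "other p"] that by blast
    then show ?thesis by (blast intro: mover_wins_mover_loses.intros(2))
  qed
qed

lemma winning_strategy_exists:
  assumes "if P = Player_I then mover_wins G Player_I s else mover_loses G Player_I s"
  shows "\<exists>\<sigma>. winning_strategy G s P \<sigma>"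
proof -
  define \<sigma> where "\<sigma> h = (SOME t. t \<in> G (to_move h) (last h) \<and> mover_loses G (other (to_move h)) t)"
    for h
  have \<sigma>: "\<sigma> h \<in> G (to_move h) (last h) \<and> mover_loses G (other (to_move h)) (\<sigma> h)"
    if "mover_wins G (to_move h) (last h)" for h
    unfolding \<sigma>_def by (rule someI_ex) (use that in \<open>cases; blast\<close>)
  have inv: "if to_move h = P then mover_wins G (to_move h) (last h)
             else mover_loses G (to_move h) (last h)"
    if "play G s h" "conforms \<sigma> P h" for h
    using that
  proof (induction rule: play.induct)
    case start
    then show ?case using assms by (cases P) (simp_all add: to_move_def)
  next
    case (step h t)
    have c: "conforms \<sigma> P h" "to_move h = P \<longrightarrow> t = \<sigma> h"
      using step conforms_snoc[OF play_nonempty[OF step.hyps(1)]] by auto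
    show ?case
    proof (cases "to_move h = P")
      case True
      then have "mover_loses G (other (to_move h)) t" using step c \<sigma>[of h] by simp
      moreover have "other P \<noteq> P" by (cases P) auto
      ultimately show ?thesis using True by (simp add: to_move_snoc)
    next
      case False
      then have "mover_loses G (to_move h) (last h)" using step c by simp
      then have "mover_wins G (other (to_move h)) t"
        using step.hyps(2) by cases blast
      moreover have "other (to_move h) = P" using False by (cases P; cases "to_move h") auto
      ultimately show ?thesis by (simp add: to_move_snoc)
    qed
  qed
  have "winning_strategy G s P \<sigma>"
    unfolding winning_strategy_def
  proof (intro allI impI)
    fix h assume "play G s h \<and> conforms \<sigma> P h"
    then have "mover_wins G (to_move h) (last h)" if "to_move h = P"
      using inv[of h] that by simp
    then show "if G (to_move h) (last h) = {} then to_move h \<noteq> P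
         else to_move h = P \<longrightarrow> \<sigma> h \<in> G P (last h)"
      using \<sigma>[of h] by (cases "to_move h = P") auto
  qed
  then show ?thesis by blast
qed

lemma winning_strategy_unique:
  fixes m :: "'s \<Rightarrow> nat"
  assumes m: "\<And>p s t. t \<in> G p s \<Longrightarrow> m t < m s"
    and "winning_strategy G s Player_I \<sigma>" "winning_strategy G s Player_II \<tau>"
  shows False
proof -
  have "False" if "play G s h" "conforms \<sigma> Player_I h" "conforms \<tau> Player_II h" for h
    using that
  proof (induction "m (last h)" arbitrary: h rule: less_induct)
    case less
    let ?t = "if to_move h = Player_I then \<sigma> h else \<tau> h"
    have 1: "if G (to_move h) (last h) = {} then to_move h \<noteq> Player_I
          else to_move h = Player_I \<longrightarrow> \<sigma> h \<in> G Player_I (last h)"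
      using assms(2) less.prems unfolding winning_strategy_def by blast
    have 2: "if G (to_move h) (last h) = {} then to_move h \<noteq> Player_II
          else to_move h = Player_II \<longrightarrow> \<tau> h \<in> G Player_II (last h)"
      using assms(3) less.prems unfolding winning_strategy_def by blast
    have t: "?t \<in> G (to_move h) (last h)"
      using 1 2 by (cases "to_move h") (auto split: if_splits)
    have "play G s (h @ [?t])" using less.prems(1) t by (rule play.step)
    moreover have "conforms \<sigma> Player_I (h @ [?t])" "conforms \<tau> Player_II (h @ [?t])"
      using less.prems by (simp_all add: conforms_snoc play_nonempty)
    ultimately show False using less.hyps[of "h @ [?t]"] m[OF t] by simp
  qed
  from this[OF play.start conforms_singleton conforms_singleton] show False .
qed

lemma ex1_winner:
  fixes m :: "'s \<Rightarrow> nat"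
  assumes m: "\<And>p s t. t \<in> G p s \<Longrightarrow> m t < m s"
  shows "\<exists>!P. \<exists>\<sigma>. winning_strategy G s P \<sigma>"
proof -
  have no_both: False
    if "\<exists>\<sigma>. winning_strategy G s Player_I \<sigma>" "\<exists>\<sigma>. winning_strategy G s Player_II \<sigma>"
  proof -
    from that obtain \<sigma> \<tau> where
      st: "winning_strategy G s Player_I \<sigma>" "winning_strategy G s Player_II \<tau>" by blast
    show False
      by (rule winning_strategy_unique[where m = m, OF _ st]) (rule m)
  qed
  have "mover_wins G Player_I s \<or> mover_loses G Player_I s"
    by (rule mover_wins_or_loses[where m = m]) (rule m)
  then have "\<exists>P \<sigma>. winning_strategy G s P \<sigma>"
  proof
    assume "mover_wins G Player_I s"
    then show ?thesis using winning_strategy_exists[of Player_I G s] by auto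
  next
    assume "mover_loses G Player_I s"
    then show ?thesis using winning_strategy_exists[of Player_II G s] by auto
  qed
  moreover have "P = Q"
    if "\<exists>\<sigma>. winning_strategy G s P \<sigma>" "\<exists>\<sigma>. winning_strategy G s Q \<sigma>" for P Q
    using that no_both by (cases P; cases Q) blast+
  ultimately show ?thesis by (rule ex_ex1I)
qed

lemma remove_less: "0 \<notin> A \<Longrightarrow> a \<in> A \<Longrightarrow> a \<le> n \<Longrightarrow> n - a < n" for a n :: nat
  by (cases a) auto

lemma ex1_winner_nim:
  assumes "0 \<notin> A"
  shows "\<exists>!P. \<exists>\<sigma>. winning_strategy (nim A) n P \<sigma>"
  by (rule ex1_winner[of _ "\<lambda>n. n"]) (use assms in \<open>auto simp: nim_def intro: remove_less\<close>)

lemma ex1_winner_nim_cash: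
  assumes "0 \<notin> A"
  shows "\<exists>!P. \<exists>\<sigma>. winning_strategy (nim_cash A) s P \<sigma>"
proof (rule ex1_winner[of _ fst])
  fix p and s t :: "nat \<times> nat \<times> nat"
  assume "t \<in> nim_cash A p s"
  then show "fst t < fst s"
    using assms by (cases p; cases s) (auto intro: remove_less)
qed


section \<open>The thresholds and the exceptional set\<close>

text \<open>
  Everything is stated over \<^typ>\<open>int\<close>, so that no subtraction is truncated; \<open>div\<close> rounds down, and
  the ceiling of \<open>i / 2\<close> is \<open>(i + 1) div 2\<close>.  Throughout, \<open>L = 2 * \<ell>\<close>, and
  \<open>n = k * (L + 1) + i\<close> with \<open>0 \<le> i \<le> L\<close>.
\<close>

definition f :: "nat \<Rightarrow> nat \<Rightarrow> int" where
  "f L n = (let k = int (n div (L + 1)); i = int (n mod (L + 1)) in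
     if i < int L then int L * k + (i + 1) div 2 else int L * (k + 1))"

definition f_bot :: "nat \<Rightarrow> nat \<Rightarrow> int" where
  "f_bot L n = (let k = int (n div (L + 1)); i = int (n mod (L + 1)); l = int L div 2 in
     if n < L then int n div 2
     else if i < int L then int L * k + i div 2 - l + 1
     else int L * k + l)"

text \<open>\<open>f_player L P n\<close> is \<open>f\<close> for the winner \<open>P\<close> of NIM without cash, and \<open>f_bot\<close> for the loser.\<close>

definition f_player :: "nat \<Rightarrow> player \<Rightarrow> nat \<Rightarrow> int" where
  "f_player L P n = (if W {1, L} n = P then f L n else f_bot L n)"

fun g_player :: "player \<Rightarrow> nat \<Rightarrow> int" where
  "g_player Player_I n = (if even n then int n div 2 + 1 else (int n - 1) div 2 + 1)"
| "g_player Player_II n = (if even n then int n div 2 else (int n - 1) div 2 + 1)"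

definition X :: "nat \<Rightarrow> (int \<times> int \<times> int) set" where
  "X L = {(i, x, y). 0 \<le> i \<and> i \<le> int L \<and> 0 \<le> x \<and> 0 \<le> y \<and>
     (even i \<and> i \<le> int L - 2 \<longrightarrow> x < (y div (int L - 1)) * (int L - 1)) \<and>
     (odd i \<and> i \<le> int L - 1 \<or> i = int L \<longrightarrow> (x div (int L - 1)) * (int L - 1) \<le> y)}"

end

theory Submission
  imports Defs
begin

text \<open>
  Exchanging the names of the players shows that \<open>(n; d, e)\<close> is won by the mover iff some legal
  removal of \<open>a\<close> stones leads to a position \<open>(n - a; e, d - a)\<close> that is lost by its mover.  The theorem
  is then a closed form for this recursion, in two regimes.

  If \<open>d\<close> or \<open>e\<close> is below its bound \<open>g\<close>, the money decides: the richer player, with ties against the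
  mover, wins by taking single stones (\<open>W_cash_below_g\<close>).

  Otherwise call the residues \<open>0, 2, \<dots>, L - 2\<close> modulo \<open>L + 1\<close> cold; these are the positions that the
  mover loses in ordinary NIM.  Let \<open>x\<close> and \<open>y\<close> be the amounts that the mover and the other player
  lack for the thresholds \<open>f\<close>, counted in whole multiples of \<open>L - 1\<close>, with \<open>-1\<close> for a player who
  reaches his threshold.  The claim is that the mover wins iff \<open>x < y\<close> at a cold position and
  iff \<open>x \<le> y\<close> at any other (\<open>W_cash_above_g\<close>).  Between them the two
  regimes cover every position, and each part of the theorem is read off from them.

  The proof is by induction on \<open>n\<close>.  Taking one stone exchanges the two shortages and, at residues
  other than \<open>L\<close>, exchanges \<open><\<close> and \<open>\<le>\<close> as well, so the claim for \<open>n - 1\<close> is exactly the claim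
  for \<open>n\<close>.  From residue \<open>L\<close> to \<open>L - 1\<close> the relation stays \<open>\<le>\<close>, but the mover's threshold falls by
  \<open>L - 1\<close> dollars more than he spends, which lowers \<open>x\<close> by one unit, and \<open>\<not> y \<le> x - 1\<close> is again
  \<open>x \<le> y\<close>.  (At \<open>n = L\<close> itself the fall is smaller, but there \<open>y = -1\<close> and it makes no difference.)
  The one exception is that \<open>-1\<close> cannot drop: when both players reach their thresholds at residue
  \<open>L\<close>, the mover has to take \<open>L\<close> stones.
  Nowhere else does taking \<open>L\<close> stones help, because it never lowers the mover's own shortage nor
  raises that of the other player (\<open>f_player_remove_L\<close>).
\<close>

section \<open>Recursion for the winner\<close>

lemma mover_not_wins_and_loses:
  "mover_wins G p s \<Longrightarrow> \<not> mover_loses G p s"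
  "mover_loses G p s \<Longrightarrow> \<not> mover_wins G p s"
proof (induction rule: mover_wins_mover_loses.inducts)
  case (1 t p s)
  then show ?case by (auto elim: mover_loses.cases)
next
  case (2 p s)
  then show ?case by (auto elim: mover_wins.cases)
qed

lemma mover_wins_iff:
  fixes m :: "'s \<Rightarrow> nat"
  assumes "\<And>p s t. t \<in> G p s \<Longrightarrow> m t < m s"
  shows "mover_wins G p s \<longleftrightarrow> (\<exists>t\<in>G p s. \<not> mover_wins G (other p) t)"
proof -
  have "mover_wins G p' s' \<or> mover_loses G p' s'" for p' s'
    by (rule mover_wins_or_loses[where m = m]) (rule assms)
  then show ?thesis
    using mover_not_wins_and_loses by (metis mover_wins.cases mover_wins_mover_loses.intros(1))
qed

lemma winner_eq_Player_I_iff: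
  fixes m :: "'s \<Rightarrow> nat"
  assumes m: "\<And>p s t. t \<in> G p s \<Longrightarrow> m t < m s"
  shows "winner G s = Player_I \<longleftrightarrow> mover_wins G Player_I s"
proof -
  have ex1: "\<exists>!P. \<exists>\<sigma>. winning_strategy G s P \<sigma>"
    by (rule ex1_winner[where m = m]) (rule m)
  show ?thesis
  proof (cases "mover_wins G Player_I s")
    case True
    then have "\<exists>\<sigma>. winning_strategy G s Player_I \<sigma>"
      using winning_strategy_exists[of Player_I G s] by simp
    then have "winner G s = Player_I"
      unfolding winner_def by (rule the1_equality[OF ex1])
    then show ?thesis using True by simp
  next
    case False
    then have "mover_loses G Player_I s"
      using mover_wins_or_loses[where m = m and G = G and p = Player_I and s = s] m by blast
    then have "\<exists>\<sigma>. winning_strategy G s Player_II \<sigma>"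
      using winning_strategy_exists[of Player_II G s] by simp
    then have "winner G s = Player_II"
      unfolding winner_def by (rule the1_equality[OF ex1])
    then show ?thesis using False by simp
  qed
qed

lemma nim_decreases: "0 \<notin> A \<Longrightarrow> t \<in> nim A p n \<Longrightarrow> t < n"
  by (auto simp: nim_def intro: remove_less)

lemma nim_cash_decreases: "0 \<notin> A \<Longrightarrow> t \<in> nim_cash A p s \<Longrightarrow> fst t < fst s"
  by (cases p; cases s) (auto intro: remove_less)

text \<open>
  The moves of NIM are the same for both players, and those of NIM with cash are once the purses are
  exchanged.  This turns the alternation of players into a recursion on Player I's wins alone.
\<close>

lemma nim_swap_players:
  assumes "0 \<notin> A"
  shows "mover_wins (nim A) Player_II n \<longleftrightarrow> mover_wins (nim A) Player_I n"
proof (induction n rule: less_induct)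
  case (less n)
  note step = mover_wins_iff[where G = "nim A" and m = "\<lambda>n. n", OF nim_decreases[OF assms]]
  have "nim A Player_II n = nim A Player_I n" by (simp add: nim_def)
  then show ?case
    using less nim_decreases[OF assms] step[where p = Player_I and s = n]
      step[where p = Player_II and s = n] by auto
qed

lemma W_rec:
  assumes "0 \<notin> A"
  shows "W A n = Player_I \<longleftrightarrow> (\<exists>a\<in>A. a \<le> n \<and> W A (n - a) \<noteq> Player_I)"
proof -
  note dec = nim_decreases[OF assms]
  have W: "W A k = Player_I \<longleftrightarrow> mover_wins (nim A) Player_I k" for k
    unfolding W_def by (rule winner_eq_Player_I_iff[where m = "\<lambda>n. n"]) (rule dec)
  have "mover_wins (nim A) Player_I n
      \<longleftrightarrow> (\<exists>t\<in>nim A Player_I n. \<not> mover_wins (nim A) Player_II t)"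
    using mover_wins_iff[where G = "nim A" and m = "\<lambda>n. n", OF dec, where p = Player_I and s = n] by auto
  then show ?thesis
    unfolding W nim_swap_players[OF assms] by (auto simp: nim_def)
qed

lemma nim_cash_swap_players:
  assumes "0 \<notin> A"
  shows "mover_wins (nim_cash A) Player_II (n, e, d) \<longleftrightarrow> mover_wins (nim_cash A) Player_I (n, d, e)"
proof (induction n arbitrary: d e rule: less_induct)
  case (less n)
  note step = mover_wins_iff[where G = "nim_cash A" and m = fst, OF nim_cash_decreases[OF assms]]
  have IH: "mover_wins (nim_cash A) Player_II (n - a, y, x)
      \<longleftrightarrow> mover_wins (nim_cash A) Player_I (n - a, x, y)" if "a \<in> A" "a \<le> n" for a x y
    using less remove_less[OF assms that] by blast
  have "mover_wins (nim_cash A) Player_II (n, e, d) \<longleftrightarrow>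
      (\<exists>a\<in>A. a \<le> n \<and> a \<le> d \<and> \<not> mover_wins (nim_cash A) Player_I (n - a, e, d - a))"
    by (subst step) auto
  also have "\<dots> \<longleftrightarrow>
      (\<exists>a\<in>A. a \<le> n \<and> a \<le> d \<and> \<not> mover_wins (nim_cash A) Player_II (n - a, d - a, e))"
    using IH by blast
  also have "\<dots> \<longleftrightarrow> mover_wins (nim_cash A) Player_I (n, d, e)"
    by (subst (2) step) auto
  finally show ?case .
qed

lemma W_cash_rec:
  assumes "0 \<notin> A"
  shows "W_cash A n d e = Player_I \<longleftrightarrow>
    (\<exists>a\<in>A. a \<le> n \<and> a \<le> d \<and> W_cash A (n - a) e (d - a) \<noteq> Player_I)"
proof -
  note dec = nim_cash_decreases[OF assms]
  have W: "W_cash A k x y = Player_I \<longleftrightarrow> mover_wins (nim_cash A) Player_I (k, x, y)" for k x y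
    unfolding W_cash_def by (rule winner_eq_Player_I_iff[where m = fst]) (rule dec)
  have "mover_wins (nim_cash A) Player_I (n, d, e)
      \<longleftrightarrow> (\<exists>t\<in>nim_cash A Player_I (n, d, e). \<not> mover_wins (nim_cash A) Player_II t)"
    using mover_wins_iff[where G = "nim_cash A" and m = fst, OF dec, where p = Player_I and s = "(n, d, e)"] by auto
  then show ?thesis
    by (auto simp: W nim_cash_swap_players[OF assms])
qed

lemma g_player_eq:
  "g_player Player_I n = int (n div 2) + 1"
  "g_player Player_II n = int ((n + 1) div 2)"
  by (cases "even n"; auto elim!: evenE oddE)+

declare g_player.simps [simp del]

text \<open>
  Comparing \<open>v\<close> with the largest multiple of \<open>m\<close> up to \<open>u\<close>, as in \<^const>\<open>X\<close>, is comparing quotients; in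
  that form the two comparisons of \<^const>\<open>X\<close> are visibly monotone, and each is the negation of the
  other with the arguments exchanged.
\<close>

lemma quotient_le_iff:
  fixes m u v :: int
  assumes "0 < m"
  shows "u div m * m \<le> v \<longleftrightarrow> u div m \<le> v div m"
proof
  assume "u div m * m \<le> v"
  then have "u div m * m div m \<le> v div m" using assms by (intro zdiv_mono1)
  then show "u div m \<le> v div m" using assms by simp
next
  assume "u div m \<le> v div m"
  then have "u div m * m \<le> v div m * m" using assms by simp
  also have "\<dots> \<le> v" using assms by (simp add: minus_mod_eq_div_mult[symmetric])
  finally show "u div m * m \<le> v" .
qed

context
  fixes l L :: nat
  assumes l: "1 \<le> l" and L: "L = 2 * l"
begin

lemma L_facts: "even L" "2 \<le> L" "L div 2 = l" "int L = 2 * int l" "l < L"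
  using l L by simp_all

section \<open>When money decides\<close>

lemma W_cash_step:
  "W_cash {1, L} n d e = Player_I \<longleftrightarrow>
     1 \<le> n \<and> 1 \<le> d \<and> W_cash {1, L} (n - 1) e (d - 1) \<noteq> Player_I \<or>
     L \<le> n \<and> L \<le> d \<and> W_cash {1, L} (n - L) e (d - L) \<noteq> Player_I"
  using l L by (subst W_cash_rec) auto

text \<open>
  When one of the players is below his bound \<open>g\<close> and only single stones are taken, somebody's money
  runs out no later than the stones do, so the richer player wins, ties going against the mover.
  Single stones are also the best choice: one costs one dollar, while taking \<open>L\<close> stones costs \<open>L\<close> dollars and lowers the bounds only by
  \<open>L / 2\<close>.  The two bounds trade places, up to the dollar just spent, when one stone is removed,
  which is why the hypothesis is preserved.
\<close>

lemma W_cash_below_g: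
  assumes "int d < g_player Player_I n \<or> int e < g_player Player_II n"
  shows "W_cash {1, L} n d e = Player_I \<longleftrightarrow> e < d"
  using assms
proof (induction n arbitrary: d e rule: less_induct)
  case (less n)
  show ?case
  proof (cases "d = 0")
    case True
    then show ?thesis using W_cash_step[of n d e] L_facts by simp
  next
    case False
    then have n: "1 \<le> n" using less.prems by (cases n) (auto simp: g_player_eq)
    have g: "g_player Player_I (n - 1) = g_player Player_II n"
        "g_player Player_II (n - 1) = g_player Player_I n - 1"
      using n unfolding g_player_eq by linarith+
    have one: "W_cash {1, L} (n - 1) e (d - 1) = Player_I \<longleftrightarrow> d - 1 < e"
      by (rule less.IH) (use less.prems g n False in auto)
    have more: "W_cash {1, L} (n - L) e (d - L) = Player_I" if "L \<le> n" "L \<le> d" "d \<le> e"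
    proof -
      have "int d < g_player Player_I n"
        using less.prems \<open>d \<le> e\<close> unfolding g_player_eq by linarith
      then have "int (d - L) < g_player Player_II (n - L)"
        using that l unfolding g_player_eq L by linarith
      then have "W_cash {1, L} (n - L) e (d - L) = Player_I \<longleftrightarrow> d - L < e"
        by (intro less.IH) (use that L_facts in auto)
      then show ?thesis using that L_facts by simp
    qed
    show ?thesis
    proof (cases "e < d")
      case True
      then show ?thesis using W_cash_step[of n d e] one n by auto
    next
      case e: False
      then show ?thesis using W_cash_step[of n d e] one more False by auto
    qed
  qed
qed

section \<open>Thresholds and residues modulo \<open>L + 1\<close>\<close>

definition pos :: "nat \<Rightarrow> nat \<Rightarrow> nat" where
  "pos k i = k * (L + 1) + i"

lemma pos_cases:
  obtains k i where "n = pos k i" "i \<le> L"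
proof
  show "n = pos (n div (L + 1)) (n mod (L + 1))"
    unfolding pos_def by (rule div_mult_mod_eq[symmetric])
  show "n mod (L + 1) \<le> L"
    using mod_less_divisor[of "L + 1" n] by linarith
qed

lemma pos_div_mod:
  assumes "i \<le> L"
  shows "pos k i div (L + 1) = k" "pos k i mod (L + 1) = i"
  using assms unfolding pos_def
  by (simp_all only: div_mult_self3[OF nat.discI] mod_mult_self3 div_less mod_less less_Suc_eq_le
      Suc_eq_plus1[symmetric] add_0_right)

lemma pos_remove:
  "pos k (Suc i) - 1 = pos k i"
  "pos (Suc k) 0 - 1 = pos k L"
  "pos (Suc k) i - L = pos k (Suc i)"
  "pos k L - L = pos k 0"
  by (simp_all add: pos_def)

definition cold :: "nat \<Rightarrow> bool" where
  "cold n \<longleftrightarrow> even (n mod (L + 1)) \<and> n mod (L + 1) < L"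

lemma cold_pos: "i \<le> L \<Longrightarrow> cold (pos k i) \<longleftrightarrow> even i \<and> i < L"
  unfolding cold_def by (simp only: pos_div_mod)

lemma cold_remove_one:
  assumes "1 \<le> n"
  shows "cold (n - 1) \<longleftrightarrow> \<not> cold n \<and> n mod (L + 1) \<noteq> L"
proof -
  obtain k i where n: "n = pos k i" "i \<le> L" by (rule pos_cases)
  have i: "n mod (L + 1) = i" using n by (simp only: pos_div_mod)
  show ?thesis
  proof (cases i)
    case 0
    then obtain k' where "k = Suc k'" using assms n by (cases k) (auto simp: pos_def)
    then show ?thesis unfolding i using 0 L_facts n by (simp only: pos_remove cold_pos) (simp add: cold_pos)
  next
    case (Suc j)
    then show ?thesis unfolding i using L_facts n by (simp only: pos_remove cold_pos) (auto simp: cold_pos)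
  qed
qed

lemma cold_remove_L:
  assumes "L \<le> n" "n mod (L + 1) \<noteq> L - 1"
  shows "cold (n - L) \<longleftrightarrow> \<not> cold n"
proof -
  obtain k i where n: "n = pos k i" "i \<le> L" by (rule pos_cases)
  have i: "n mod (L + 1) = i" using n by (simp only: pos_div_mod)
  show ?thesis
  proof (cases "i = L")
    case True
    then show ?thesis using L_facts n by (simp add: pos_remove cold_pos)
  next
    case False
    then obtain k' where "k = Suc k'" using assms n by (cases k) (auto simp: pos_def)
    then show ?thesis using False i assms L_facts n by (auto simp: pos_remove cold_pos)
  qed
qed

lemma not_cold_remove_L:
  assumes "L \<le> n" "n mod (L + 1) = L - 1"
  shows "\<not> cold n" "\<not> cold (n - L)"
proof -
  obtain k i where n: "n = pos k i" "i \<le> L" by (rule pos_cases)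
  have i: "n mod (L + 1) = i" using n by (simp only: pos_div_mod)
  then have "i \<noteq> L" using assms l L by simp
  then obtain k' where "k = Suc k'" using assms n by (cases k) (auto simp: pos_def)
  then show "\<not> cold n" "\<not> cold (n - L)"
    using \<open>i \<noteq> L\<close> i assms L_facts n by (auto simp: pos_remove cold_pos)
qed

lemma W_step:
  "W {1, L} n = Player_I \<longleftrightarrow>
     1 \<le> n \<and> W {1, L} (n - 1) \<noteq> Player_I \<or> L \<le> n \<and> W {1, L} (n - L) \<noteq> Player_I"
  using l L by (subst W_rec) auto

lemma W_eq: "W {1, L} n = Player_I \<longleftrightarrow> \<not> cold n"
proof (induction n rule: less_induct)
  case (less n)
  have one: "W {1, L} (n - 1) = Player_I \<longleftrightarrow> \<not> cold (n - 1)" if "1 \<le> n"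
    using less that by simp
  have more: "W {1, L} (n - L) = Player_I \<longleftrightarrow> \<not> cold (n - L)" if "L \<le> n"
    using less that l L by simp
  have "cold 0" using L_facts by (simp add: cold_def)
  moreover have "L \<le> n" "n mod (L + 1) \<noteq> L - 1" if "n mod (L + 1) = L"
    using that mod_less_eq_dividend[of n "L + 1"] L_facts by auto
  ultimately show ?case
    using W_step[of n] one more cold_remove_one[of n] cold_remove_L[of n] not_cold_remove_L[of n]
    by (cases "n = 0") (auto simp: Suc_le_eq)
qed

lemma f_player_pos:
  assumes "i \<le> L"
  shows "f_player L Player_I (pos k i) =
      (if i = L then int L * int k + int L
       else if odd i then int L * int k + int (Suc i div 2)
       else if k = 0 then int (i div 2) else int L * int k + int (i div 2) - int l + 1)"
    "f_player L Player_II (pos k i) =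
      (if i = L then int L * int k + int l
       else if even i then int L * int k + int (Suc i div 2)
       else if k = 0 then int (i div 2) else int L * int k + int (i div 2) - int l + 1)"
proof -
  have "pos k i < L \<longleftrightarrow> k = 0 \<and> i < L" by (cases k) (auto simp: pos_def)
  moreover have "W {1, L} (pos k i) = Player_I \<longleftrightarrow> \<not> (even i \<and> i < L)"
    using W_eq cold_pos[OF assms] by simp
  moreover have "W {1, L} (pos k i) = Player_II \<longleftrightarrow> W {1, L} (pos k i) \<noteq> Player_I"
    by (cases "W {1, L} (pos k i)") auto
  moreover have "(1 + int i) div 2 = int (Suc i div 2)" "int i div 2 = int (i div 2)"
    by linarith+
  moreover have "pos k i = i" if "k = 0" using that by (simp add: pos_def)
  moreover have "int L div 2 = int l" using L by simp
  ultimately show "f_player L Player_I (pos k i) =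
      (if i = L then int L * int k + int L
       else if odd i then int L * int k + int (Suc i div 2)
       else if k = 0 then int (i div 2) else int L * int k + int (i div 2) - int l + 1)"
    "f_player L Player_II (pos k i) =
      (if i = L then int L * int k + int l
       else if even i then int L * int k + int (Suc i div 2)
       else if k = 0 then int (i div 2) else int L * int k + int (i div 2) - int l + 1)"
    using assms unfolding f_player_def f_def f_bot_def Let_def pos_div_mod[OF assms]
    by (auto simp: algebra_simps)
qed

text \<open>
  The mover's threshold one stone later is the other player's present one.  His own drops by the dollar
  that the stone costs, except at residue \<open>L\<close>: there it drops by \<open>L\<close>, so that the mover gains \<open>L - 1\<close>
  dollars (only \<open>l\<close> when no complete period of \<open>L + 1\<close> stones remains).
\<close>

lemma f_player_remove_one:
  assumes "1 \<le> n"
  shows "f_player L Player_I (n - 1) = f_player L Player_II n" (is ?A)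
    "f_player L Player_II (n - 1) =
       f_player L Player_I n - (if n mod (L + 1) \<noteq> L then 1 else if n = L then int l + 1 else int L)" (is ?B)
proof -
  obtain k i where n: "n = pos k i" "i \<le> L" by (rule pos_cases)
  have i: "n mod (L + 1) = i" using n by (simp only: pos_div_mod)
  have "?A \<and> ?B"
  proof (cases i)
    case 0
    then obtain k' where k: "k = Suc k'" using assms n by (cases k) (auto simp: pos_def)
    show ?thesis unfolding i unfolding n k 0 pos_remove
      using L_facts by (simp add: f_player_pos algebra_simps)
  next
    case (Suc j)
    have eq: "n = L \<longleftrightarrow> k = 0" if "i = L" using n that by (cases k) (auto simp: pos_def)
    show ?thesis
    proof (cases "i = L")
      case True
      then have "odd j" "j div 2 = l - 1" "Suc j div 2 = l" using Suc L l by presburger+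
      moreover have "n - 1 = pos k j" unfolding n(1) Suc by (rule pos_remove)
      moreover have "j \<noteq> L" "j \<le> L" "int (l - 1) = int l - 1"
        using Suc True l by simp_all
      ultimately show ?thesis unfolding i eq[OF True]
        using True L_facts n by (auto simp: f_player_pos algebra_simps)
    next
      case False
      then show ?thesis unfolding i unfolding n unfolding Suc pos_remove
        using Suc L_facts n by (cases "even j") (auto simp: f_player_pos algebra_simps elim!: evenE oddE)
    qed
  qed
  then show ?A ?B by auto
qed

text \<open>
  Taking \<open>L\<close> stones is never a gain against the thresholds: the other player, now to move, has at most
  his old threshold to reach, and the mover's own falls by at most the \<open>L\<close> dollars spent.
\<close>

lemma f_player_remove_L:
  assumes "L \<le> n"
  shows "f_player L Player_I (n - L) \<le> f_player L Player_II n" (is ?A)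
    "f_player L Player_I n - int L \<le> f_player L Player_II (n - L)" (is ?B)
    "n mod (L + 1) = L \<Longrightarrow> f_player L Player_II (n - L) = f_player L Player_I n - int L" (is "_ \<Longrightarrow> ?C")
proof -
  obtain k i where n: "n = pos k i" "i \<le> L" by (rule pos_cases)
  have i: "n mod (L + 1) = i" using n by (simp only: pos_div_mod)
  have "?A \<and> ?B \<and> (i = L \<longrightarrow> ?C)"
  proof (cases "i = L")
    case True
    show ?thesis unfolding n unfolding True pos_remove
      using L_facts by (simp add: f_player_pos algebra_simps)
  next
    case False
    then obtain k' where k: "k = Suc k'" using assms n by (cases k) (auto simp: pos_def)
    show ?thesis unfolding n k pos_remove
      using False L_facts n by (cases "even i") (auto simp: f_player_pos algebra_simps elim!: evenE oddE)
  qed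
  then show ?A ?B "n mod (L + 1) = L \<Longrightarrow> ?C" using i by auto
qed

text \<open>
  From \<open>L\<close> stones on the thresholds \<open>f\<close> dominate the bounds \<open>g\<close>, so only for \<open>n < L\<close> can a player
  reach his \<open>f\<close> without reaching his \<open>g\<close>.
\<close>

lemma g_le_f:
  assumes "L \<le> n"
  shows "g_player Player_I n \<le> f_player L Player_I n" "g_player Player_II n \<le> f_player L Player_II n"
proof -
  obtain k i where n: "n = pos k i" "i \<le> L" by (rule pos_cases)
  have eq: "int n = 2 * (int l * int k) + int k + int i" using n L_facts by (simp add: pos_def algebra_simps)
  have Lk: "int L * int k = 2 * (int l * int k)" using L_facts by simp
  have g: "2 * g_player Player_I n \<le> int n + 2" "2 * g_player Player_II n \<le> int n + 1"
    unfolding g_player_eq by (cases "even n"; auto elim!: evenE oddE)+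
  have lk: "int k \<le> int l * int k" using l by (cases k) simp_all
  have "int l + int k - 1 \<le> int l * int k" if "k \<noteq> 0"
  proof -
    have "0 \<le> (int l - 1) * (int k - 1)" using l that by simp
    then show ?thesis by (simp add: algebra_simps)
  qed
  moreover have "k \<noteq> 0" if "i \<noteq> L" using assms n that by (cases k) (auto simp: pos_def)
  ultimately have "g_player Player_I n \<le> f_player L Player_I (pos k i) \<and>
      g_player Player_II n \<le> f_player L Player_II (pos k i)"
    unfolding f_player_pos[OF n(2)] Lk
    using g lk L_facts eq n(2) by (auto elim!: evenE oddE)
  then show "g_player Player_I n \<le> f_player L Player_I n" "g_player Player_II n \<le> f_player L Player_II n"
    using n by auto
qed

lemma g_f_small:
  assumes "n < L"
  shows "cold n \<longleftrightarrow> even n"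
    "f_player L Player_I n = (if even n then g_player Player_I n - 1 else g_player Player_I n)"
    "f_player L Player_II n = (if even n then g_player Player_II n else g_player Player_II n - 1)"
proof -
  have n: "n = pos 0 n" by (simp add: pos_def)
  show "cold n \<longleftrightarrow> even n" using assms cold_pos[of n 0] n by simp
  show "f_player L Player_I n = (if even n then g_player Player_I n - 1 else g_player Player_I n)"
    "f_player L Player_II n = (if even n then g_player Player_II n else g_player Player_II n - 1)"
    using assms f_player_pos[of n 0] n by (auto simp: g_player_eq elim!: oddE)
qed

lemma f_eq_g_at_L: "f_player L Player_II L = g_player Player_II L"
  using f_player_pos(2)[of L 0] L_facts by (simp add: pos_def g_player_eq)

lemma L_le_f_player:
  assumes "n mod (L + 1) = L"
  shows "int L \<le> f_player L Player_I n"
proof -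
  obtain k i where n: "n = pos k i" "i \<le> L" by (rule pos_cases)
  have i: "n mod (L + 1) = i" using n by (simp only: pos_div_mod)
  show ?thesis using assms unfolding i unfolding n by (simp add: f_player_pos)
qed

lemma g_le_f_multiple:
  assumes "L \<le> n" "n mod (L + 1) = L"
  shows "g_player Player_II (n - L) \<le> f_player L Player_II (n - L)"
proof (cases "L \<le> n - L")
  case True
  then show ?thesis by (rule g_le_f)
next
  case False
  then show ?thesis using g_f_small[of "n - L"] cold_remove_L[of n] assms L_facts
    by (simp add: cold_def)
qed

section \<open>Shortage\<close>

text \<open>
  Only the number of whole multiples of \<open>L - 1\<close> lacking matters, since \<open>L - 1\<close> is the amount that one
  move from residue \<open>L\<close> recovers.  Cutting off at \<open>-1\<close> expresses that money beyond the threshold has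
  no value; the extra \<open>- 1\<close> makes the quotient negative exactly when \<open>c\<close> reaches \<open>t\<close>.
\<close>

definition shortage :: "int \<Rightarrow> nat \<Rightarrow> int" where
  "shortage t c = max (-1) ((t - int c - 1) div (int L - 1))"

lemma L_ge_2: "2 \<le> int L" using l L by simp

lemma shortage_ge: "-1 \<le> shortage t c" by (simp add: shortage_def)

lemma shortage_mono:
  assumes "t - int c \<le> t' - int c'"
  shows "shortage t c \<le> shortage t' c'"
  unfolding shortage_def using assms L_ge_2 by (intro max.mono zdiv_mono1) auto

lemma shortage_nonneg_iff: "0 \<le> shortage t c \<longleftrightarrow> int c < t"
proof -
  have "0 \<le> (t - int c - 1) div (int L - 1) \<longleftrightarrow> 0 \<le> t - int c - 1"
    using L_ge_2 by (intro pos_imp_zdiv_nonneg_iff) simp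
  then show ?thesis unfolding shortage_def by linarith
qed

lemma shortage_eq_minus_one_iff: "shortage t c = -1 \<longleftrightarrow> t \<le> int c"
  using shortage_nonneg_iff[of t c] shortage_ge[of t c] by linarith

lemma shortage_minus:
  assumes "t' - int c' = t - int c - (int L - 1)"
  shows "shortage t' c' = max (-1) (shortage t c - 1)"
proof -
  have "(t' - int c' - 1) div (int L - 1) = ((t - int c - 1) + (-1) * (int L - 1)) div (int L - 1)"
    using assms by (intro arg_cong2[of _ _ _ _ "(div)"]) simp_all
  also have "\<dots> = (t - int c - 1) div (int L - 1) - 1"
    using L_ge_2 by (subst div_mult_self1) simp_all
  finally show ?thesis unfolding shortage_def by simp
qed

text \<open>
  At cold positions ties go against the mover.  With two rich players (both shortages \<open>-1\<close>) this rule
  returns the winner of NIM without cash.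
\<close>

definition mover_ahead :: "nat \<Rightarrow> nat \<Rightarrow> nat \<Rightarrow> bool" where
  "mover_ahead n d e \<longleftrightarrow>
     (let x = shortage (f_player L Player_I n) d; y = shortage (f_player L Player_II n) e
      in if cold n then x < y else x \<le> y)"

text \<open>
  Removing one stone keeps both players at or above their bounds \<open>g\<close>, so the induction hypothesis
  always applies to that move.  Removing \<open>L\<close> stones may bring the mover below his; he is then the
  poorer player and loses by \<open>W_cash_below_g\<close>.
\<close>

lemma W_cash_above_g:
  assumes "g_player Player_I n \<le> int d" "g_player Player_II n \<le> int e"
  shows "W_cash {1, L} n d e = Player_I \<longleftrightarrow> mover_ahead n d e"
  using assms
proof (induction n arbitrary: d e rule: less_induct)
  case (less n)
  define x where "x = shortage (f_player L Player_I n) d"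
  define y where "y = shortage (f_player L Player_II n) e"
  have ahead: "mover_ahead n d e \<longleftrightarrow> (if cold n then x < y else x \<le> y)"
    by (simp add: mover_ahead_def x_def y_def)
  have d: "1 \<le> d" using less.prems by (simp add: g_player_eq)
  show ?case
  proof (cases "n = 0")
    case True
    have "x = -1" "y = -1"
      using less.prems g_f_small[of 0] l L True unfolding x_def y_def shortage_eq_minus_one_iff by auto
    then show ?thesis
      using True ahead cold_def l L W_cash_step[of 0 d e] by simp
  next
    case False
    then have n: "1 \<le> n" by simp
    have g1: "g_player Player_I (n - 1) = g_player Player_II n"
        "g_player Player_II (n - 1) = g_player Player_I n - 1"
      using False unfolding g_player_eq by linarith+
    have one: "W_cash {1, L} (n - 1) e (d - 1) = Player_I \<longleftrightarrow> mover_ahead (n - 1) e (d - 1)"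
      using less.prems g1 d n by (intro less.IH) auto
    have y1: "shortage (f_player L Player_I (n - 1)) e = y"
      unfolding f_player_remove_one(1)[OF n] y_def ..
    define x1 where "x1 = shortage (f_player L Player_II (n - 1)) (d - 1)"
    have one': "W_cash {1, L} (n - 1) e (d - 1) = Player_I \<longleftrightarrow> (if cold (n - 1) then y < x1 else y \<le> x1)"
      unfolding one mover_ahead_def Let_def y1 x1_def ..
    define y2 where "y2 = shortage (f_player L Player_I (n - L)) e"
    define x2 where "x2 = shortage (f_player L Player_II (n - L)) (d - L)"
    have more: "W_cash {1, L} (n - L) e (d - L) = Player_I \<longleftrightarrow>
        int (d - L) < g_player Player_II (n - L) \<or> (if cold (n - L) then y2 < x2 else y2 \<le> x2)"
      if "L \<le> n"
    proof -
      have e: "g_player Player_I (n - L) \<le> int e"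
        using less.prems that l unfolding g_player_eq L by linarith
      show ?thesis
      proof (cases "int (d - L) < g_player Player_II (n - L)")
        case True
        then have "d - L < e" using e unfolding g_player_eq by linarith
        then show ?thesis using W_cash_below_g[of e "n - L" "d - L"] True by simp
      next
        case False
        then have "W_cash {1, L} (n - L) e (d - L) = Player_I \<longleftrightarrow> mover_ahead (n - L) e (d - L)"
          using e that l L n by (intro less.IH) auto
        then show ?thesis using False by (simp add: mover_ahead_def x2_def y2_def)
      qed
    qed
    have xy2: "y2 \<le> y" "x \<le> x2" if "L \<le> n" "L \<le> d"
      unfolding x_def y_def x2_def y2_def
      using f_player_remove_L[OF that(1)] that(2) by (intro shortage_mono; simp)+
    \<comment> \<open>Residue \<open>L - 1\<close> is the only one from which this move does not switch between \<open><\<close> and \<open>\<le>\<close>;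
      there \<open>y \<le> x\<close> is needed after the move, which \<open>y < x\<close> before it provides.\<close>
    have useless: "W_cash {1, L} (n - L) e (d - L) = Player_I"
      if "\<not> mover_ahead n d e" "L \<le> n" "L \<le> d"
      using that ahead more xy2 cold_remove_L[of n] not_cold_remove_L[of n]
      by (cases "n mod (L + 1) = L - 1") (auto split: if_splits)
    show ?thesis
    proof (cases "n mod (L + 1) = L")
      case False
      have "x1 = x"
        unfolding x1_def x_def shortage_def using f_player_remove_one(2)[OF n] False d by simp
      then have "W_cash {1, L} (n - 1) e (d - 1) \<noteq> Player_I \<longleftrightarrow> mover_ahead n d e"
        unfolding one' ahead using cold_remove_one[OF n] False by auto
      then show ?thesis using W_cash_step[of n d e] n d useless by blast
    next
      case top: True
      then have Ln: "L \<le> n" using mod_less_eq_dividend[of n "L + 1"] by simp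
      have hot: "\<not> cold n" "\<not> cold (n - 1)" "cold (n - L)"
        using cold_remove_one[OF n] cold_remove_L[OF Ln] top L_facts by (auto simp: cold_def)
      have "mover_ahead n d e \<longleftrightarrow> x \<le> y" using ahead hot by simp
      \<comment> \<open>The mover's money covers the threshold even after paying \<open>L\<close> dollars, and the other player
        faces a cold position with equal shortages \<open>-1\<close>.\<close>
      have rich: "L \<le> d \<and> W_cash {1, L} (n - L) e (d - L) \<noteq> Player_I" if "x = -1" "y = -1"
      proof -
        have fd: "f_player L Player_I n \<le> int d" using that(1) unfolding x_def shortage_eq_minus_one_iff .
        have "int L \<le> f_player L Player_I n" by (rule L_le_f_player) (rule top)
        then have "L \<le> d" using fd by simp
        then have "int (d - L) \<ge> f_player L Player_II (n - L)"
          using fd f_player_remove_L(3)[OF Ln top] by simp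
        then have "x2 = -1" "\<not> int (d - L) < g_player Player_II (n - L)"
          using g_le_f_multiple[OF Ln top] unfolding x2_def shortage_eq_minus_one_iff by linarith+
        then show ?thesis using \<open>L \<le> d\<close> more[OF Ln] hot shortage_ge unfolding y2_def by (simp add: not_less)
      qed
      have "W_cash {1, L} (n - 1) e (d - 1) \<noteq> Player_I \<longleftrightarrow> x \<le> y \<and> \<not> (x = -1 \<and> y = -1)"
      proof (cases "n = L")
        \<comment> \<open>Here the threshold and \<open>g\<close> agree for the other player, so he is rich; then one stone never
          wins, whatever \<open>x\<close> is, and the formula does not depend on by how much \<open>x\<close> drops.\<close>
        case True
        then have "y = -1" using less.prems f_eq_g_at_L unfolding y_def shortage_eq_minus_one_iff by simp
        then show ?thesis using one' hot shortage_ge[of _ d] shortage_ge[of _ "d - 1"]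
          unfolding x_def x1_def by (metis order_antisym)
      next
        case False
        then have "x1 = max (-1) (x - 1)"
          unfolding x1_def x_def
          using f_player_remove_one(2)[OF n] top d by (intro shortage_minus) simp
        moreover have "-1 \<le> x" "-1 \<le> y" unfolding x_def y_def by (rule shortage_ge)+
        ultimately show ?thesis using one' hot by (auto simp: max_def)
      qed
      then show ?thesis
        using W_cash_step[of n d e] n d Ln rich useless \<open>mover_ahead n d e \<longleftrightarrow> x \<le> y\<close> by auto
    qed
  qed
qed

lemma in_X_iff_mover_ahead:
  assumes "int d < f_player L Player_I n" "int e < f_player L Player_II n"
  shows "(int (n mod (L + 1)), f_player L Player_I n - int d - 1, f_player L Player_II n - int e - 1) \<in> X L
    \<longleftrightarrow> mover_ahead n d e"
proof -
  define x where "x = f_player L Player_I n - int d - 1"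
  define y where "y = f_player L Player_II n - int e - 1"
  have q: "u div (int L - 1) * (int L - 1) \<le> v \<longleftrightarrow> u div (int L - 1) \<le> v div (int L - 1)" for u v
    by (rule quotient_le_iff) (use L_ge_2 in simp)
  have s: "shortage (f_player L Player_I n) d = x div (int L - 1)"
    "shortage (f_player L Player_II n) e = y div (int L - 1)"
    using assms shortage_nonneg_iff[of "f_player L Player_I n" d] shortage_nonneg_iff[of "f_player L Player_II n" e]
    unfolding shortage_def x_def y_def by linarith+
  have xy: "0 \<le> x" "0 \<le> y" using assms by (simp_all add: x_def y_def)
  have "even L" by (rule L_facts)
  have n: "n mod (L + 1) \<le> L" using mod_less_divisor[of "L + 1" n] by linarith
  have X: "(int i, x, y) \<in> X L \<longleftrightarrow>
      (if even i \<and> i < L then \<not> y div (int L - 1) * (int L - 1) \<le> x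
       else x div (int L - 1) * (int L - 1) \<le> y)" if "i \<le> L" for i
  proof -
    have even_case: "even i \<and> int i \<le> int L - 2 \<longleftrightarrow> even i \<and> i < L"
      using \<open>even L\<close> by presburger
    have odd_case: "odd i \<and> int i \<le> int L - 1 \<or> int i = int L \<longleftrightarrow> \<not> (even i \<and> i < L)"
      using \<open>even L\<close> that by auto
    have "0 \<le> int i" "int i \<le> int L" using that by simp_all
    then show ?thesis
      using xy by (simp only: X_def mem_Collect_eq prod.case even_of_nat even_case odd_case not_le) auto
  qed
  show ?thesis
    unfolding x_def[symmetric] y_def[symmetric] X[OF n] q mover_ahead_def Let_def s cold_def
    by (simp only: not_le)
qed

end

theorem theorem5p7:
  fixes L n d e :: nat
  assumes "L \<ge> 2" and "even L"
  shows
    "(int d \<ge> f_player L Player_I n \<and> int e < f_player L Player_II n \<longrightarrow>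
        W_cash {1, L} n d e = Player_I) \<and>
     (int d < f_player L Player_I n \<and> int e \<ge> f_player L Player_II n \<longrightarrow>
        W_cash {1, L} n d e = Player_II) \<and>
     (int d \<ge> f_player L Player_I n \<and> int e \<ge> f_player L Player_II n \<longrightarrow>
        W_cash {1, L} n d e = W {1, L} n) \<and>
     (int d \<ge> g_player Player_I n \<and> int e < g_player Player_II n \<longrightarrow>
        W_cash {1, L} n d e = Player_I) \<and>
     (int d < g_player Player_I n \<and> int e \<ge> g_player Player_II n \<longrightarrow>
        W_cash {1, L} n d e = Player_II) \<and>
     (int d < g_player Player_I n \<and> int e < g_player Player_II n \<longrightarrow>
        (W_cash {1, L} n d e = Player_I \<longleftrightarrow> d > e)) \<and>
     (g_player Player_I n \<le> int d \<and> int d < f_player L Player_I n \<and>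
      g_player Player_II n \<le> int e \<and> int e < f_player L Player_II n \<longrightarrow>
        (let i = int (n mod (L + 1));
             b = f_player L Player_I n - int d - 1;
             b' = f_player L Player_II n - int e - 1
         in W_cash {1, L} n d e = Player_I \<longleftrightarrow> (i, b, b') \<in> X L))"
proof -
  define l where "l = L div 2"
  have l: "1 \<le> l" "L = 2 * l" using assms by (auto simp: l_def)
  note below = W_cash_below_g[OF l, of d n e] and above = W_cash_above_g[OF l, of n d e]
    and X = in_X_iff_mover_ahead[OF l, of d n e] and W = W_eq[OF l, of n]
  let ?fI = "f_player L Player_I n" and ?fII = "f_player L Player_II n"
  let ?gI = "g_player Player_I n" and ?gII = "g_player Player_II n"
  have II: "P \<noteq> Player_I \<longleftrightarrow> P = Player_II" for P by (cases P) auto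
  note short = shortage_eq_minus_one_iff[OF l] and long = shortage_nonneg_iff[OF l]
  have ahead: "mover_ahead L n d e \<longleftrightarrow> int e < ?fII \<or> \<not> cold L n" if "?fI \<le> int d"
    using that short[of ?fI d] shortage_ge[OF l, of ?fII e] long[of ?fII e]
    unfolding mover_ahead_def[OF l] Let_def by auto
  have behind: "\<not> mover_ahead L n d e" if "int d < ?fI" "?fII \<le> int e"
    using that short[of ?fII e] long[of ?fI d]
    unfolding mover_ahead_def[OF l] Let_def by auto
  have g: "?gII \<le> ?gI" "?gI \<le> ?gII + 1" unfolding g_player_eq by linarith+
  \<comment> \<open>For \<open>n < L\<close> one of the two thresholds is a single dollar below its bound, so that a player
    can reach his \<open>f\<close> while money still decides.\<close>
  have order: "?gI \<le> ?fI \<and> ?gII \<le> ?fII \<or>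
    even n \<and> cold L n \<and> ?fI = ?gI - 1 \<and> ?fII = ?gII \<and> ?gI = ?gII + 1 \<or>
    odd n \<and> \<not> cold L n \<and> ?fI = ?gI \<and> ?fII = ?gII - 1 \<and> ?gI = ?gII"
    using g_le_f[OF l, of n] g_f_small[OF l, of n] by (cases "L \<le> n") (auto simp: g_player.simps)
  have 1: "W_cash {1, L} n d e = Player_I" if "?fI \<le> int d" "int e < ?fII"
    using that order g below above ahead by linarith
  have 2: "W_cash {1, L} n d e \<noteq> Player_I" if "int d < ?fI" "?fII \<le> int e"
    using that order g below above behind by linarith
  have 3: "W_cash {1, L} n d e = Player_I \<longleftrightarrow> W {1, L} n = Player_I" if "?fI \<le> int d" "?fII \<le> int e"
    using that order g below above ahead unfolding W by linarith
  have 3: "W_cash {1, L} n d e = W {1, L} n" if "?fI \<le> int d" "?fII \<le> int e"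
    using 3[OF that] II by metis
  have 4: "W_cash {1, L} n d e = Player_I" if "?gI \<le> int d" "int e < ?gII"
    using that below g by linarith
  have 5: "W_cash {1, L} n d e \<noteq> Player_I" if "int d < ?gI" "?gII \<le> int e"
    using that below g by linarith
  show ?thesis
    unfolding Let_def II[symmetric] using 1 2 3 4 5 below above X by blast
qed

end
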